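(* Let $a\in\mathbb{R}$, $\alpha>0$, let $w:\mathbb{N}_a\to\mathbb{R}\setminus\{0\}$ satisfy $\frac{w(a)}{w(k)}>0$ for all $k\in\mathbb{N}_{a+1}$, and let $u,v:\mathbb{N}_{a+1}\to\mathbb{R}_+$. Let $p,q\in\mathbb{R}$ satisfy $\frac1p+\frac1q=1$. If $p>1$, then for all $k\in\mathbb{N}_{a+1}$, $${}_a^{\rm G}\nabla_k^{-\alpha,w(k)}[u(k)v(k)]\le \big[{}_a^{\rm G}\nabla_k^{-\alpha,w(k)}u^p(k)\big]^{\frac1p}\big[{}_a^{\rm G}\nabla_k^{-\alpha,w(k)}v^q(k)\big]^{\frac1q}.$$ If $p\in(0,1)$, then for all $k\in\mathbb{N}_{a+1}$, $${}_a^{\rm G}\nabla_k^{-\alpha,w(k)}[u(k)v(k)]\ge \big[{}_a^{\rm G}\nabla_k^{-\alpha,w(k)}u^p(k)\big]^{\frac1p}\big[{}_a^{\rm G}\nabla_k^{-\alpha,w(k)}v^q(k)\big]^{\frac1q}.$$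
   Context: For $a\in\mathbb{R}$, $\mathbb{N}_a:=\{a,a+1,a+2,\dots\}$. $\mathbb{R}_+$ is the set of positive real numbers. The rising function is $p^{\overline{q}}:=\frac{\Gamma(p+q)}{\Gamma(p)}$. For $\alpha>0$ and $k\in\mathbb{N}_{a+1}$, the Grünwald–Letnikov fractional sum is ${}_a^{\rm G}\nabla_k^{-\alpha}x(k):=\sum_{j=a+1}^{k}\frac{(k-j+1)^{\overline{\alpha-1}}}{\Gamma(\alpha)}x(j)$, and the tempered sum is ${}_a^{\rm G}\nabla_k^{-\alpha,w(k)}x(k):=w^{-1}(k)\,{}_a^{\rm G}\nabla_k^{-\alpha}[w(k)x(k)]=\sum_{j=a+1}^{k}\frac{(k-j+1)^{\overline{\alpha-1}}}{\Gamma(\alpha)}\frac{w(j)}{w(k)}x(j)$. *)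

theory Defs
  imports "HOL-Analysis.Analysis"
begin

text \<open>Functions on the discrete half-line are total functions on the reals of which only the values
  on the half-line matter.\<close>

definition nats_from :: "real \<Rightarrow> real set" where
  "nats_from a = {a + real n | n. True}"

definition rising :: "real \<Rightarrow> real \<Rightarrow> real" where
  "rising p q = Gamma (p + q) / Gamma p"

text \<open>The index set is \<open>{a + 1, a + 2, \<dots>, k}\<close> whenever \<open>k \<in> nats_from (a + 1)\<close>; it is finite for
  every real \<open>k\<close>, so the sum never falls back to the default value 0 of an infinite sum.\<close>

definition gl_sum :: "real \<Rightarrow> real \<Rightarrow> (real \<Rightarrow> real) \<Rightarrow> real \<Rightarrow> real" where
  "gl_sum a \<alpha> x k =
     (\<Sum>j | j \<in> nats_from (a + 1) \<and> j \<le> k. rising (k - j + 1) (\<alpha> - 1) / Gamma \<alpha> * x j)"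

definition tempered_gl_sum ::
    "real \<Rightarrow> real \<Rightarrow> (real \<Rightarrow> real) \<Rightarrow> (real \<Rightarrow> real) \<Rightarrow> real \<Rightarrow> real" where
  "tempered_gl_sum a \<alpha> w x k = inverse (w k) * gl_sum a \<alpha> (\<lambda>j. w j * x j) k"

lemma gl_sum_index_set:
  "{j. j \<in> nats_from (a + 1) \<and> j \<le> a + 1 + real m} = (\<lambda>n. a + 1 + real n) ` {..m}"
  by (auto simp: nats_from_def)

lemma finite_gl_sum_index_set: "finite {j. j \<in> nats_from (a + 1) \<and> j \<le> k}"
proof (rule finite_subset)
  show "{j. j \<in> nats_from (a + 1) \<and> j \<le> k} \<subseteq>
          {j. j \<in> nats_from (a + 1) \<and> j \<le> a + 1 + real (nat \<lceil>k - a - 1\<rceil>)}"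
    by (auto intro: order_trans[of _ k]) linarith
  show "finite {j. j \<in> nats_from (a + 1) \<and> j \<le> a + 1 + real (nat \<lceil>k - a - 1\<rceil>)}"
    unfolding gl_sum_index_set by simp
qed

lemma tempered_gl_sum_altdef:
  "tempered_gl_sum a \<alpha> w x k =
     (\<Sum>j | j \<in> nats_from (a + 1) \<and> j \<le> k.
        rising (k - j + 1) (\<alpha> - 1) / Gamma \<alpha> * (w j / w k) * x j)"
  unfolding tempered_gl_sum_def gl_sum_def sum_distrib_left
  by (rule sum.cong) (simp_all add: divide_inverse mult_ac)

end

theory Submission
  imports Defs
begin

text \<open>
  Both inequalities are weighted forms of Hoelder's inequality for finite sums. The summation kernel
  \<open>\<Gamma>(k - j + \<alpha>) / (\<Gamma>(k - j + 1) \<Gamma>(\<alpha>)) \<cdot> w j / w k\<close> is strictly positive: the Gamma factors have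
  positive arguments, and all values of \<open>w\<close> on the half-line share the sign of \<open>w a\<close>. So the
  tempered sum is a sum against positive weights, to which the interpolation inequality
  \<open>\<Sum> c x\<^sup>s y\<^sup>1\<^sup>-\<^sup>s \<le> (\<Sum> c x)\<^sup>s (\<Sum> c y)\<^sup>1\<^sup>-\<^sup>s\<close> for \<open>0 \<le> s \<le> 1\<close> applies
  (\<open>sum_geometric_mean_le\<close>).

  For \<open>p > 1\<close> take \<open>x = u\<^sup>p\<close>, \<open>y = v\<^sup>q\<close>, \<open>s = 1 / p\<close>. For \<open>0 < p < 1\<close>, where \<open>q < 0\<close>, take
  \<open>x = u v\<close>, \<open>y = v\<^sup>q\<close>, \<open>s = p\<close>: the left-hand sum becomes \<open>\<Sum> c u\<^sup>p\<close>, because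
  \<open>p + q (1 - p) = 0\<close>, and solving for \<open>\<Sum> c u v\<close> gives the reversed inequality
  (\<open>reverse_Hoelder_sum_powr\<close>).
\<close>

text \<open>
  After dividing \<open>x\<close> and \<open>y\<close> by their weighted sums \<open>X\<close> and \<open>Y\<close>, the termwise Young inequalities add
  up to \<open>s + (1 - s) = 1\<close>.
\<close>

lemma sum_geometric_mean_le:
  fixes c x y :: "'a \<Rightarrow> real" and s :: real
  assumes "finite A" "A \<noteq> {}" "0 \<le> s" "s \<le> 1"
    and c: "\<And>j. j \<in> A \<Longrightarrow> c j > 0"
    and x: "\<And>j. j \<in> A \<Longrightarrow> x j > 0"
    and y: "\<And>j. j \<in> A \<Longrightarrow> y j > 0"
  shows "(\<Sum>j\<in>A. c j * (x j powr s * y j powr (1 - s)))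
    \<le> (\<Sum>j\<in>A. c j * x j) powr s * (\<Sum>j\<in>A. c j * y j) powr (1 - s)"
proof -
  define X where "X = (\<Sum>j\<in>A. c j * x j)"
  define Y where "Y = (\<Sum>j\<in>A. c j * y j)"
  have X: "X > 0" and Y: "Y > 0"
    unfolding X_def Y_def using assms by (auto intro!: sum_pos)
  have "(\<Sum>j\<in>A. c j * (x j powr s * y j powr (1 - s)))
      \<le> (\<Sum>j\<in>A. X powr s * Y powr (1 - s) * (s * (c j * x j) / X + (1 - s) * (c j * y j) / Y))"
  proof (rule sum_mono)
    fix j assume j: "j \<in> A"
    have "(x j / X) powr s * (y j / Y) powr (1 - s) \<le> s * (x j / X) + (1 - s) * (y j / Y)"
      using x[OF j] y[OF j] X Y assms(3,4) by (intro Youngs_inequality_0) auto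
    then have "c j * (X powr s * Y powr (1 - s)) * ((x j / X) powr s * (y j / Y) powr (1 - s))
        \<le> c j * (X powr s * Y powr (1 - s)) * (s * (x j / X) + (1 - s) * (y j / Y))"
      using c[OF j] by (intro mult_left_mono) auto
    moreover have "c j * (X powr s * Y powr (1 - s)) * ((x j / X) powr s * (y j / Y) powr (1 - s))
        = c j * (x j powr s * y j powr (1 - s))"
      using x[OF j] y[OF j] X Y by (simp add: powr_divide)
    moreover have "c j * (X powr s * Y powr (1 - s)) * (s * (x j / X) + (1 - s) * (y j / Y))
        = X powr s * Y powr (1 - s) * (s * (c j * x j) / X + (1 - s) * (c j * y j) / Y)"
      using X Y by (simp add: field_simps)
    ultimately show "c j * (x j powr s * y j powr (1 - s))
        \<le> X powr s * Y powr (1 - s) * (s * (c j * x j) / X + (1 - s) * (c j * y j) / Y)"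
      by (simp only:)
  qed
  also have "\<dots> = X powr s * Y powr (1 - s) * (s * X / X + (1 - s) * Y / Y)"
    by (simp add: sum.distrib flip: sum_distrib_left sum_divide_distrib X_def Y_def)
  also have "\<dots> = X powr s * Y powr (1 - s)"
    using X Y by simp
  finally show ?thesis
    unfolding X_def Y_def .
qed

lemma Hoelder_sum_powr:
  fixes c u v :: "'a \<Rightarrow> real" and p q :: real
  assumes "finite A" "A \<noteq> {}" "1 < p" "1 / p + 1 / q = 1"
    and c: "\<And>j. j \<in> A \<Longrightarrow> c j > 0"
    and u: "\<And>j. j \<in> A \<Longrightarrow> u j > 0"
    and v: "\<And>j. j \<in> A \<Longrightarrow> v j > 0"
  shows "(\<Sum>j\<in>A. c j * (u j * v j))
    \<le> (\<Sum>j\<in>A. c j * u j powr p) powr (1 / p) * (\<Sum>j\<in>A. c j * v j powr q) powr (1 / q)"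
proof -
  have q: "1 / q = 1 - 1 / p" using assms(4) by simp
  have "q \<noteq> 0" using assms(3,4) by auto
  have "(\<Sum>j\<in>A. c j * (u j * v j))
      = (\<Sum>j\<in>A. c j * ((u j powr p) powr (1 / p) * (v j powr q) powr (1 / q)))"
    using u v \<open>1 < p\<close> \<open>q \<noteq> 0\<close> by (intro sum.cong) (auto simp: powr_powr less_imp_le)
  also have "\<dots> \<le> (\<Sum>j\<in>A. c j * u j powr p) powr (1 / p) * (\<Sum>j\<in>A. c j * v j powr q) powr (1 / q)"
    unfolding q using assms(1,2,3) c u v
    by (intro sum_geometric_mean_le) (auto simp: less_imp_neq[THEN not_sym])
  finally show ?thesis .
qed

text \<open>
  Factoring \<open>u\<^sup>p = (u v)\<^sup>p v\<^sup>-\<^sup>p\<close> turns the reversed inequality into an ordinary one with the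
  mixed sum on the larger side. The conjugate exponent satisfies \<open>q (1 - p) = - p\<close>, which makes
  the second factor a power of \<open>v\<^sup>q\<close>.
\<close>

lemma reverse_Hoelder_sum_powr:
  fixes c u v :: "'a \<Rightarrow> real" and p q :: real
  assumes "finite A" "A \<noteq> {}" "0 < p" "p < 1" "1 / p + 1 / q = 1"
    and c: "\<And>j. j \<in> A \<Longrightarrow> c j > 0"
    and u: "\<And>j. j \<in> A \<Longrightarrow> u j > 0"
    and v: "\<And>j. j \<in> A \<Longrightarrow> v j > 0"
  shows "(\<Sum>j\<in>A. c j * u j powr p) powr (1 / p) * (\<Sum>j\<in>A. c j * v j powr q) powr (1 / q)
    \<le> (\<Sum>j\<in>A. c j * (u j * v j))"
proof -
  define U where "U = (\<Sum>j\<in>A. c j * u j powr p)"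
  define V where "V = (\<Sum>j\<in>A. c j * v j powr q)"
  define W where "W = (\<Sum>j\<in>A. c j * (u j * v j))"
  have pos: "U > 0" "V > 0" "W > 0"
    unfolding U_def V_def W_def using assms(1,2) c u v
    by (auto intro!: sum_pos mult_pos_pos simp: less_imp_neq[THEN not_sym])
  have "q \<noteq> 0" using assms(4,5) by auto
  then have pq: "p + q * (1 - p) = 0" and conj: "(1 - p) / p = - (1 / q)"
    using assms(3,5) by (auto simp: field_simps)
  have "U = (\<Sum>j\<in>A. c j * ((u j * v j) powr p * (v j powr q) powr (1 - p)))"
    unfolding U_def
  proof (rule sum.cong)
    fix j assume j: "j \<in> A"
    have "v j powr p * v j powr (q * (1 - p)) = 1"
      using v[OF j] by (simp flip: powr_add add: pq)
    then show "c j * u j powr p = c j * ((u j * v j) powr p * (v j powr q) powr (1 - p))"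
      using u[OF j] v[OF j] by (simp add: powr_powr powr_mult mult.assoc)
  qed simp
  also have "\<dots> \<le> W powr p * V powr (1 - p)"
    unfolding W_def V_def using assms(1-4) c u v
    by (intro sum_geometric_mean_le) (auto simp: less_imp_neq[THEN not_sym])
  finally have "U powr (1 / p) \<le> (W powr p * V powr (1 - p)) powr (1 / p)"
    using pos assms(3) by (intro powr_mono2) auto
  also have "\<dots> = W * V powr (- (1 / q))"
    using pos assms(3) by (simp add: powr_mult powr_powr flip: conj)
  finally have "U powr (1 / p) * V powr (1 / q) \<le> W * V powr (- (1 / q)) * V powr (1 / q)"
    by (intro mult_right_mono) auto
  also have "\<dots> = W"
    using pos by (simp add: powr_minus)
  finally show ?thesis
    unfolding U_def V_def W_def .
qed

lemma rising_pos: "rising x y > 0" if "x > 0" "x + y > 0"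
  using that by (simp add: rising_def Gamma_real_pos)

text \<open>
  Both \<open>w j\<close> and \<open>w k\<close> have the sign of \<open>w a\<close>, so their quotient is positive. For \<open>j \<le> k\<close> the
  Gamma function in the rising factor is taken at \<open>k - j + \<alpha> > 0\<close> and \<open>k - j + 1 > 0\<close>.
\<close>

lemma tempered_gl_sum_kernel_pos:
  fixes a \<alpha> :: real and w :: "real \<Rightarrow> real"
  assumes "\<alpha> > 0" "\<forall>k \<in> nats_from (a + 1). w a / w k > 0"
    and "k \<in> nats_from (a + 1)" "j \<in> nats_from (a + 1)" "j \<le> k"
  shows "rising (k - j + 1) (\<alpha> - 1) / Gamma \<alpha> * (w j / w k) > 0"
proof -
  have "w a / w k > 0" "w a / w j > 0"
    using assms by auto
  then have "w j / w k > 0"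
    by (auto simp: zero_less_divide_iff)
  moreover have "rising (k - j + 1) (\<alpha> - 1) > 0"
    using assms by (intro rising_pos) auto
  ultimately show ?thesis
    using assms(1) by (intro mult_pos_pos[OF divide_pos_pos]) auto
qed

theorem theorem3p18:
  fixes a \<alpha> p q :: real and w u v :: "real \<Rightarrow> real"
  assumes "\<alpha> > 0"
    and "\<forall>k \<in> nats_from a. w k \<noteq> 0"
    and "\<forall>k \<in> nats_from (a + 1). w a / w k > 0"
    and "\<forall>k \<in> nats_from (a + 1). u k > 0"
    and "\<forall>k \<in> nats_from (a + 1). v k > 0"
    and "1 / p + 1 / q = 1"
  shows "(p > 1 \<longrightarrow> (\<forall>k \<in> nats_from (a + 1).
            tempered_gl_sum a \<alpha> w (\<lambda>j. u j * v j) k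
              \<le> tempered_gl_sum a \<alpha> w (\<lambda>j. u j powr p) k powr (1 / p)
                * tempered_gl_sum a \<alpha> w (\<lambda>j. v j powr q) k powr (1 / q)))
       \<and> (0 < p \<and> p < 1 \<longrightarrow> (\<forall>k \<in> nats_from (a + 1).
            tempered_gl_sum a \<alpha> w (\<lambda>j. u j * v j) k
              \<ge> tempered_gl_sum a \<alpha> w (\<lambda>j. u j powr p) k powr (1 / p)
                * tempered_gl_sum a \<alpha> w (\<lambda>j. v j powr q) k powr (1 / q)))"
proof -
  have goal: "(p > 1 \<longrightarrow> tempered_gl_sum a \<alpha> w (\<lambda>j. u j * v j) k
        \<le> tempered_gl_sum a \<alpha> w (\<lambda>j. u j powr p) k powr (1 / p)
          * tempered_gl_sum a \<alpha> w (\<lambda>j. v j powr q) k powr (1 / q))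
    \<and> (0 < p \<and> p < 1 \<longrightarrow> tempered_gl_sum a \<alpha> w (\<lambda>j. u j * v j) k
        \<ge> tempered_gl_sum a \<alpha> w (\<lambda>j. u j powr p) k powr (1 / p)
          * tempered_gl_sum a \<alpha> w (\<lambda>j. v j powr q) k powr (1 / q))"
    if k: "k \<in> nats_from (a + 1)" for k
  proof -
    define A where "A = {j. j \<in> nats_from (a + 1) \<and> j \<le> k}"
    define c where "c j = rising (k - j + 1) (\<alpha> - 1) / Gamma \<alpha> * (w j / w k)" for j
    have A: "finite A" "A \<noteq> {}"
      using k finite_gl_sum_index_set[of a k] by (auto simp: A_def)
    have c: "c j > 0" and u: "u j > 0" and v: "v j > 0" if "j \<in> A" for j
      using that assms(4,5) tempered_gl_sum_kernel_pos[OF assms(1,3) k]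
      by (auto simp: A_def c_def)
    have sum: "tempered_gl_sum a \<alpha> w x k = (\<Sum>j\<in>A. c j * x j)" for x
      unfolding tempered_gl_sum_altdef A_def c_def ..
    show ?thesis
      unfolding sum
    proof (intro conjI impI)
      assume "1 < p"
      then show "(\<Sum>j\<in>A. c j * (u j * v j))
        \<le> (\<Sum>j\<in>A. c j * u j powr p) powr (1 / p) * (\<Sum>j\<in>A. c j * v j powr q) powr (1 / q)"
        using A c u v assms(6) by (intro Hoelder_sum_powr)
    next
      assume "0 < p \<and> p < 1"
      then show "(\<Sum>j\<in>A. c j * u j powr p) powr (1 / p) * (\<Sum>j\<in>A. c j * v j powr q) powr (1 / q)
        \<le> (\<Sum>j\<in>A. c j * (u j * v j))"
        using A c u v assms(6) by (intro reverse_Hoelder_sum_powr) auto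
    qed
  qed
  then show ?thesis by blast
qed

end
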